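(* Let $(A,\mu,\alpha,\beta,R)$ be a Rota-Baxter BiHom-alternative algebra of weight $0$ such that $R$ commutes with $\alpha$ and $\beta$. Define a new multiplication on $A$ by $$\mu_R(x,y)=\mu(R(x),y)+\mu(x,R(y))\quad\text{for all }x,y\in A.$$ Then $A_R=(A,\mu_R,\alpha,\beta)$ is a BiHom-alternative algebra.
   Context: $\mathbb{K}$ is an algebraically closed field of characteristic $0$; all vector spaces and (multi)linear maps are over $\mathbb{K}$. A BiHom-algebra $(A,\mu,\alpha,\beta)$ is a vector space $A$ with a bilinear map $\mu:A\times A\to A$ and linear maps $\alpha,\beta:A\to A$ with $\alpha\beta=\beta\alpha$. It is multiplicative if $\alpha(\mu(x,y))=\mu(\alpha(x),\alpha(y))$ and $\beta(\mu(x,y))=\mu(\beta(x),\beta(y))$ for all $x,y\in A$. Its BiHom-associator is $as_{\alpha,\beta}(x,y,z)=\mu(\mu(x,y),\beta(z))-\mu(\alpha(x),\mu(y,z))$. A BiHom-alternative algebra is a multiplicative BiHom-algebra satisfying, for all $x,y,z\in A$, $as_{\alpha,\beta}(\beta(x),\alpha(y),z)+as_{\alpha,\beta}(\beta(y),\alpha(x),z)=0$ and $as_{\alpha,\beta}(x,\beta(y),\alpha(z))+as_{\alpha,\beta}(x,\beta(z),\alpha(y))=0$. A Rota-Baxter operator of weight $\lambda\in\mathbb{K}$ on a BiHom-algebra $(A,\mu,\alpha,\beta)$ is a linear map $R:A\to A$ with $\mu(R(x),R(y))=R(\mu(R(x),y)+\mu(x,R(y))+\lambda\mu(x,y))$ for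 all $x,y\in A$. A Rota-Baxter BiHom-alternative algebra of weight $\lambda$ is a BiHom-alternative algebra together with a Rota-Baxter operator of weight $\lambda$ on it. *)

theory Defs
  imports "HOL-Computational_Algebra.Polynomial"
begin

definition bilinear_mult ::
  "('k::field \<Rightarrow> 'a::ab_group_add \<Rightarrow> 'a) \<Rightarrow> ('a \<Rightarrow> 'a \<Rightarrow> 'a) \<Rightarrow> bool" where
  "bilinear_mult scale \<mu> \<longleftrightarrow>
     (\<forall>x. Vector_Spaces.linear scale scale (\<lambda>y. \<mu> x y)) \<and>
     (\<forall>y. Vector_Spaces.linear scale scale (\<lambda>x. \<mu> x y))"

definition bihom_associator ::
  "('a::ab_group_add \<Rightarrow> 'a \<Rightarrow> 'a) \<Rightarrow> ('a \<Rightarrow> 'a) \<Rightarrow> ('a \<Rightarrow> 'a) \<Rightarrow> 'a \<Rightarrow> 'a \<Rightarrow> 'a \<Rightarrow> 'a" where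
  "bihom_associator \<mu> \<alpha> \<beta> x y z = \<mu> (\<mu> x y) (\<beta> z) - \<mu> (\<alpha> x) (\<mu> y z)"

text \<open>The underlying vector space is the whole type \<open>'a\<close>, with scalar multiplication \<open>scale\<close>;
  no finite-dimensionality is assumed. The ground field is algebraically closed of
  characteristic 0 by the sort of \<open>'k\<close>.\<close>

locale bihom_algebra = vector_space scale
  for scale :: "'k::{alg_closed_field, field_char_0} \<Rightarrow> 'a::ab_group_add \<Rightarrow> 'a" +
  fixes \<mu> :: "'a \<Rightarrow> 'a \<Rightarrow> 'a"
    and \<alpha> \<beta> :: "'a \<Rightarrow> 'a"
  assumes bilinear: "bilinear_mult scale \<mu>"
    and linear_alpha: "Vector_Spaces.linear scale scale \<alpha>"
    and linear_beta: "Vector_Spaces.linear scale scale \<beta>"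
    and alpha_beta_commute: "\<alpha> \<circ> \<beta> = \<beta> \<circ> \<alpha>"

locale multiplicative_bihom_algebra = bihom_algebra +
  assumes alpha_mult: "\<alpha> (\<mu> x y) = \<mu> (\<alpha> x) (\<alpha> y)"
    and beta_mult: "\<beta> (\<mu> x y) = \<mu> (\<beta> x) (\<beta> y)"

locale bihom_alternative_algebra = multiplicative_bihom_algebra +
  assumes left_alternative:
      "bihom_associator \<mu> \<alpha> \<beta> (\<beta> x) (\<alpha> y) z + bihom_associator \<mu> \<alpha> \<beta> (\<beta> y) (\<alpha> x) z = 0"
    and right_alternative:
      "bihom_associator \<mu> \<alpha> \<beta> x (\<beta> y) (\<alpha> z) + bihom_associator \<mu> \<alpha> \<beta> x (\<beta> z) (\<alpha> y) = 0"

locale rota_baxter_bihom_algebra = bihom_algebra scale \<mu> \<alpha> \<beta>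
  for scale :: "'k::{alg_closed_field, field_char_0} \<Rightarrow> 'a::ab_group_add \<Rightarrow> 'a"
    and \<mu> \<alpha> \<beta> +
  fixes R :: "'a \<Rightarrow> 'a"
    and weight :: 'k
  assumes linear_R: "Vector_Spaces.linear scale scale R"
    and rota_baxter: "\<mu> (R x) (R y) = R (\<mu> (R x) y + \<mu> x (R y) + scale weight (\<mu> x y))"

locale rota_baxter_bihom_alternative_algebra =
  bihom_alternative_algebra scale \<mu> \<alpha> \<beta> + rota_baxter_bihom_algebra scale \<mu> \<alpha> \<beta> R weight
  for scale :: "'k::{alg_closed_field, field_char_0} \<Rightarrow> 'a::ab_group_add \<Rightarrow> 'a"
    and \<mu> \<alpha> \<beta> R weight

definition rota_baxter_mult ::
  "('a::ab_group_add \<Rightarrow> 'a \<Rightarrow> 'a) \<Rightarrow> ('a \<Rightarrow> 'a) \<Rightarrow> 'a \<Rightarrow> 'a \<Rightarrow> 'a" where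
  "rota_baxter_mult \<mu> R x y = \<mu> (R x) y + \<mu> x (R y)"

end

theory Submission
  imports Defs
begin

text \<open>For weight \<open>0\<close> the Rota-Baxter identity says that \<open>R\<close> is multiplicative from the new product to
  the old one. Hence the new associator of \<open>(x, y, z)\<close> is the sum of the three old associators in which
  \<open>R\<close> is applied to two of the three arguments; a transposition of the arguments permutes these
  three terms, so the alternative identities transfer term by term.\<close>

context bihom_algebra
begin

lemma mult_add_left: "\<mu> (x + y) z = \<mu> x z + \<mu> y z"
  using bilinear unfolding bilinear_mult_def by (simp add: Vector_Spaces.linear_iff)

lemma mult_add_right: "\<mu> x (y + z) = \<mu> x y + \<mu> x z"
  using bilinear unfolding bilinear_mult_def by (simp add: Vector_Spaces.linear_iff)

lemma bilinear_rota_baxter_mult: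
  assumes R: "Vector_Spaces.linear scale scale R"
  shows "bilinear_mult scale (rota_baxter_mult \<mu> R)"
  using bilinear R unfolding bilinear_mult_def rota_baxter_mult_def
  by (auto simp: Vector_Spaces.linear_iff algebra_simps scale_right_distrib)

end

context rota_baxter_bihom_algebra
begin

text \<open>The term with \<open>scale weight\<close> vanishes at weight \<open>0\<close>. Used
  below to remove an \<open>R\<close> standing in front of an inner product.\<close>

lemma R_rota_baxter_mult:
  assumes "weight = 0"
  shows "R (rota_baxter_mult \<mu> R x y) = \<mu> (R x) (R y)"
  using rota_baxter[of x y] assms by (simp add: rota_baxter_mult_def)

text \<open>Each bracketing expands into three terms, one for each choice of the argument that
  escapes \<open>R\<close>. Commutation with \<alpha> and \<beta> moves \<open>R\<close> past the
  twist on the outer argument, so the terms of both bracketings match up.\<close>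

lemma bihom_associator_rota_baxter_mult:
  assumes weight: "weight = 0"
    and R_alpha: "\<And>x. R (\<alpha> x) = \<alpha> (R x)"
    and R_beta: "\<And>x. R (\<beta> x) = \<beta> (R x)"
  shows "bihom_associator (rota_baxter_mult \<mu> R) \<alpha> \<beta> x y z =
    bihom_associator \<mu> \<alpha> \<beta> (R x) (R y) z + bihom_associator \<mu> \<alpha> \<beta> (R x) y (R z)
      + bihom_associator \<mu> \<alpha> \<beta> x (R y) (R z)"
proof -
  let ?m = "rota_baxter_mult \<mu> R"
  \<comment> \<open>Only the outer product is unfolded: the inner one must stay intact for
    \<open>R_rota_baxter_mult\<close> to apply.\<close>
  have "?m (?m x y) (\<beta> z) = \<mu> (\<mu> (R x) (R y)) (\<beta> z) + \<mu> (?m x y) (\<beta> (R z))"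
    by (simp add: rota_baxter_mult_def[of _ _ "?m x y"] R_rota_baxter_mult[OF weight] R_beta)
  moreover have "?m (\<alpha> x) (?m y z) = \<mu> (\<alpha> (R x)) (?m y z) + \<mu> (\<alpha> x) (\<mu> (R y) (R z))"
    by (simp add: rota_baxter_mult_def[of _ _ "\<alpha> x"] R_rota_baxter_mult[OF weight] R_alpha)
  ultimately show ?thesis
    by (simp add: bihom_associator_def rota_baxter_mult_def[of _ _ x y]
        rota_baxter_mult_def[of _ _ y z] mult_add_left mult_add_right algebra_simps)
qed

end

theorem theorem3p8:
  fixes scale :: "'k::{alg_closed_field, field_char_0} \<Rightarrow> 'a::ab_group_add \<Rightarrow> 'a"
    and \<mu> :: "'a \<Rightarrow> 'a \<Rightarrow> 'a"
    and \<alpha> \<beta> R :: "'a \<Rightarrow> 'a"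
  assumes "rota_baxter_bihom_alternative_algebra scale \<mu> \<alpha> \<beta> R 0"
    and "R \<circ> \<alpha> = \<alpha> \<circ> R"
    and "R \<circ> \<beta> = \<beta> \<circ> R"
  shows "bihom_alternative_algebra scale (rota_baxter_mult \<mu> R) \<alpha> \<beta>"
proof -
  interpret rota_baxter_bihom_alternative_algebra scale \<mu> \<alpha> \<beta> R 0 by fact
  have R_alpha: "R (\<alpha> x) = \<alpha> (R x)" for x using assms(2) by (simp add: fun_eq_iff)
  have R_beta: "R (\<beta> x) = \<beta> (R x)" for x using assms(3) by (simp add: fun_eq_iff)
  have alpha_add: "\<alpha> (x + y) = \<alpha> x + \<alpha> y" for x y using linear_alpha by (simp add: Vector_Spaces.linear_iff)
  have beta_add: "\<beta> (x + y) = \<beta> x + \<beta> y" for x y using linear_beta by (simp add: Vector_Spaces.linear_iff)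
  note associator = bihom_associator_rota_baxter_mult[OF refl R_alpha R_beta]
  show ?thesis
  proof unfold_locales
    show "bilinear_mult scale (rota_baxter_mult \<mu> R)"
      using linear_R by (rule bilinear_rota_baxter_mult)
    show "\<alpha> (rota_baxter_mult \<mu> R x y) = rota_baxter_mult \<mu> R (\<alpha> x) (\<alpha> y)" for x y
      by (simp add: rota_baxter_mult_def alpha_add alpha_mult R_alpha)
    show "\<beta> (rota_baxter_mult \<mu> R x y) = rota_baxter_mult \<mu> R (\<beta> x) (\<beta> y)" for x y
      by (simp add: rota_baxter_mult_def beta_add beta_mult R_beta)
  next
    fix x y z
    let ?as = "bihom_associator \<mu> \<alpha> \<beta>"
    \<comment> \<open>The brackets are \<open>left_alternative\<close> at
      \<open>(R x, R y, z)\<close>, \<open>(R x, y, R z)\<close> and \<open>(x, R y, R z)\<close>.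
      As \<open>R\<close> travels with its argument, the last two brackets pair terms from different
      positions in the two expansions.\<close>
    have "bihom_associator (rota_baxter_mult \<mu> R) \<alpha> \<beta> (\<beta> x) (\<alpha> y) z
        + bihom_associator (rota_baxter_mult \<mu> R) \<alpha> \<beta> (\<beta> y) (\<alpha> x) z
      = (?as (\<beta> (R x)) (\<alpha> (R y)) z + ?as (\<beta> (R y)) (\<alpha> (R x)) z)
      + (?as (\<beta> (R x)) (\<alpha> y) (R z) + ?as (\<beta> y) (\<alpha> (R x)) (R z))
      + (?as (\<beta> x) (\<alpha> (R y)) (R z) + ?as (\<beta> (R y)) (\<alpha> x) (R z))"
      by (simp only: associator R_alpha R_beta ac_simps)
    then show "bihom_associator (rota_baxter_mult \<mu> R) \<alpha> \<beta> (\<beta> x) (\<alpha> y) z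
        + bihom_associator (rota_baxter_mult \<mu> R) \<alpha> \<beta> (\<beta> y) (\<alpha> x) z = 0"
      by (simp only: left_alternative add_0)
    \<comment> \<open>Likewise with \<open>right_alternative\<close> at
      \<open>(x, R y, R z)\<close>, \<open>(R x, R y, z)\<close> and
      \<open>(R x, y, R z)\<close>.\<close>
    have "bihom_associator (rota_baxter_mult \<mu> R) \<alpha> \<beta> x (\<beta> y) (\<alpha> z)
        + bihom_associator (rota_baxter_mult \<mu> R) \<alpha> \<beta> x (\<beta> z) (\<alpha> y)
      = (?as x (\<beta> (R y)) (\<alpha> (R z)) + ?as x (\<beta> (R z)) (\<alpha> (R y)))
      + (?as (R x) (\<beta> (R y)) (\<alpha> z) + ?as (R x) (\<beta> z) (\<alpha> (R y)))
      + (?as (R x) (\<beta> y) (\<alpha> (R z)) + ?as (R x) (\<beta> (R z)) (\<alpha> y))"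
      by (simp only: associator R_alpha R_beta ac_simps)
    then show "bihom_associator (rota_baxter_mult \<mu> R) \<alpha> \<beta> x (\<beta> y) (\<alpha> z)
        + bihom_associator (rota_baxter_mult \<mu> R) \<alpha> \<beta> x (\<beta> z) (\<alpha> y) = 0"
      by (simp only: right_alternative add_0)
  \<comment> \<open>The remaining goals do not involve the product, so they carry over from the
    original algebra.\<close>
  qed (use linear_alpha linear_beta alpha_beta_commute in \<open>simp_all add: Vector_Spaces.linear_iff\<close>)
qed

end
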